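(* Let $n,m,k\ge 0$ be integers and let $A_{n,m,k}$ be the weighted tree with $n+m+k+1$ vertices $E_0,A_1,\dots,A_n,B_1,\dots,B_m,C_1,\dots,C_k$, where $E_0$ has weight $3$, all other vertices have weight $2$, and the edges are those of the three chains $E_0 - A_1 - A_2 - \cdots - A_n$, $E_0 - B_1 - \cdots - B_m$ and $E_0 - C_1 - \cdots - C_k$. Then the number of elements of the triple root system $R(A_{n,m,k})$ is $$n^2+m^2+k^2+n+m+k+2(n+1)(m+1)(k+1).$$
   Context: For a finite weighted tree $\Gamma$ with vertices $V_i$ of weights $w_i$, the intersection form on $\bigoplus_i\mathbb{Z}V_i$ is the symmetric bilinear form with $(V_i\cdot V_i)=-w_i$ and, for $i\neq j$, $(V_i\cdot V_j)=1$ if $V_i$ and $V_j$ are joined by an edge and $0$ otherwise. A non-zero element $\sum m_iV_i$ is a positive (resp. negative) divisor if all $m_i\ge 0$ (resp. all $m_i\le 0$). The triple root system $R(\Gamma)$ is the set of all positive and negative divisors $Y$ with $(Y\cdot Y)=-2$ or $(Y\cdot Y)=-3$. *)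

theory Defs
  imports "HOL-Library.Poly_Mapping"
begin

record 'a weighted_graph =
  verts :: "'a set"
  edges :: "'a set set"
  weight :: "'a \<Rightarrow> int"

definition adj_rel :: "('a, 'b) weighted_graph_scheme \<Rightarrow> ('a \<times> 'a) set" where
  "adj_rel G = {(u, v). {u, v} \<in> edges G}"

text \<open>A cycle is given by its distinct vertices in cyclic order.\<close>

definition is_cycle :: "('a, 'b) weighted_graph_scheme \<Rightarrow> 'a list \<Rightarrow> bool" where
  "is_cycle G xs \<longleftrightarrow> 3 \<le> length xs \<and> distinct xs \<and>
     (\<forall>i < length xs. {xs ! i, xs ! (Suc i mod length xs)} \<in> edges G)"

definition weighted_tree :: "('a, 'b) weighted_graph_scheme \<Rightarrow> bool" where
  "weighted_tree G \<longleftrightarrow>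
     finite (verts G) \<and> verts G \<noteq> {} \<and>
     (\<forall>e \<in> edges G. e \<subseteq> verts G \<and> card e = 2) \<and>
     (\<forall>u \<in> verts G. \<forall>v \<in> verts G. (u, v) \<in> (adj_rel G)\<^sup>*) \<and>
     (\<nexists>xs. is_cycle G xs)"

text \<open>
  The free abelian group on the vertices of \<open>G\<close> consists of the finitely supported functions
  \<^typ>\<open>'a \<Rightarrow>\<^sub>0 int\<close> whose support \<^const>\<open>Poly_Mapping.keys\<close> lies in \<^term>\<open>verts G\<close>; the vertex
  \<open>v\<close> is the basis element \<^term>\<open>Poly_Mapping.single v (1::int)\<close>.
\<close>

definition divisor_group :: "('a, 'b) weighted_graph_scheme \<Rightarrow> ('a \<Rightarrow>\<^sub>0 int) set" where
  "divisor_group G = {Y. Poly_Mapping.keys Y \<subseteq> verts G}"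

definition vertex_form :: "('a, 'b) weighted_graph_scheme \<Rightarrow> 'a \<Rightarrow> 'a \<Rightarrow> int" where
  "vertex_form G u v = (if u = v then - weight G u else if {u, v} \<in> edges G then 1 else 0)"

definition intersection_form ::
    "('a, 'b) weighted_graph_scheme \<Rightarrow> ('a \<Rightarrow>\<^sub>0 int) \<Rightarrow> ('a \<Rightarrow>\<^sub>0 int) \<Rightarrow> int" where
  "intersection_form G Y Z =
     (\<Sum>u \<in> verts G. \<Sum>v \<in> verts G.
        Poly_Mapping.lookup Y u * Poly_Mapping.lookup Z v * vertex_form G u v)"

definition positive_divisor :: "('a, 'b) weighted_graph_scheme \<Rightarrow> ('a \<Rightarrow>\<^sub>0 int) \<Rightarrow> bool" where
  "positive_divisor G Y \<longleftrightarrow>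
     Y \<in> divisor_group G \<and> Y \<noteq> 0 \<and> (\<forall>v \<in> verts G. Poly_Mapping.lookup Y v \<ge> 0)"

definition negative_divisor :: "('a, 'b) weighted_graph_scheme \<Rightarrow> ('a \<Rightarrow>\<^sub>0 int) \<Rightarrow> bool" where
  "negative_divisor G Y \<longleftrightarrow>
     Y \<in> divisor_group G \<and> Y \<noteq> 0 \<and> (\<forall>v \<in> verts G. Poly_Mapping.lookup Y v \<le> 0)"

definition triple_root_system :: "('a, 'b) weighted_graph_scheme \<Rightarrow> ('a \<Rightarrow>\<^sub>0 int) set" where
  "triple_root_system G =
     {Y. (positive_divisor G Y \<or> negative_divisor G Y) \<and>
         (intersection_form G Y Y = -2 \<or> intersection_form G Y Y = -3)}"

definition chain_edges :: "'a list \<Rightarrow> 'a set set" where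
  "chain_edges xs = {{xs ! i, xs ! Suc i} | i. Suc i < length xs}"

datatype vertex = E0 | VA nat | VB nat | VC nat

definition A_tree :: "nat \<Rightarrow> nat \<Rightarrow> nat \<Rightarrow> vertex weighted_graph" where
  "A_tree n m k = \<lparr>
     verts = {E0} \<union> VA ` {1..n} \<union> VB ` {1..m} \<union> VC ` {1..k},
     edges = chain_edges (E0 # map VA [1..<n + 1])
           \<union> chain_edges (E0 # map VB [1..<m + 1])
           \<union> chain_edges (E0 # map VC [1..<k + 1]),
     weight = (\<lambda>v. if v = E0 then 3 else 2) \<rparr>"

lemma intersection_form_single:
  assumes "finite (verts G)" "u \<in> verts G" "v \<in> verts G"
  shows "intersection_form G (Poly_Mapping.single u 1) (Poly_Mapping.single v 1) = vertex_form G u v"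
proof -
  have "intersection_form G (Poly_Mapping.single u 1) (Poly_Mapping.single v 1) =
      (\<Sum>x \<in> verts G. if x = u then (\<Sum>y \<in> verts G. if y = v then vertex_form G x y else 0) else 0)"
    unfolding intersection_form_def
    by (intro sum.cong refl) (auto simp: lookup_single when_def intro!: sum.cong sum.neutral)
  then show ?thesis using assms by simp
qed

lemma vertex_form_sym: "vertex_form G u v = vertex_form G v u"
  by (simp add: vertex_form_def insert_commute)

lemma intersection_form_sym: "intersection_form G Y Z = intersection_form G Z Y"
  unfolding intersection_form_def
  by (subst sum.swap) (simp add: vertex_form_sym[of G] mult.commute mult.left_commute)

lemma intersection_form_add_left:
  "intersection_form G (Y + Y') Z = intersection_form G Y Z + intersection_form G Y' Z"
  by (simp add: intersection_form_def lookup_add algebra_simps sum.distrib)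

lemma chain_edges_arm:
  "chain_edges (E0 # map f [1..<n + 1]) =
     (\<lambda>i. {if i = 0 then E0 else f i, f (Suc i)}) ` {..<n}"
proof -
  have "chain_edges (E0 # map f [1..<n + 1]) =
      (\<lambda>i. {(E0 # map f [1..<n + 1]) ! i, (E0 # map f [1..<n + 1]) ! Suc i}) ` {..<n}"
    unfolding chain_edges_def image_def by (auto simp del: upt_Suc nth_Cons_Suc)
  also have "\<dots> = (\<lambda>i. {if i = 0 then E0 else f i, f (Suc i)}) ` {..<n}"
  proof (rule image_cong[OF refl])
    fix i assume "i \<in> {..<n}"
    then show "{(E0 # map f [1..<n + 1]) ! i, (E0 # map f [1..<n + 1]) ! Suc i} =
        {if i = 0 then E0 else f i, f (Suc i)}"
      by (cases i) (simp_all del: upt_Suc)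
  qed
  finally show ?thesis .
qed

fun depth :: "vertex \<Rightarrow> nat" where
  "depth E0 = 0" | "depth (VA i) = i" | "depth (VB i) = i" | "depth (VC i) = i"

fun parent :: "vertex \<Rightarrow> vertex" where
  "parent E0 = E0"
| "parent (VA i) = (if i = 1 then E0 else VA (i - 1))"
| "parent (VB i) = (if i = 1 then E0 else VB (i - 1))"
| "parent (VC i) = (if i = 1 then E0 else VC (i - 1))"

lemma edges_A_tree:
  "edges (A_tree n m k) = (\<lambda>v. {parent v, v}) ` (verts (A_tree n m k) - {E0})"
proof -
  have arm: "chain_edges (E0 # map f [1..<n + 1]) = (\<lambda>v. {parent v, v}) ` f ` {1..n}"
    if "\<And>i. parent (f i) = (if i = 1 then E0 else f (i - 1))" for f n
  proof -
    have n: "{1..n} = Suc ` {..<n}"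
      using image_Suc_lessThan by simp
    show ?thesis
      unfolding chain_edges_arm n image_image by (intro image_cong refl) (simp add: that)
  qed
  have "verts (A_tree n m k) - {E0} = VA ` {1..n} \<union> VB ` {1..m} \<union> VC ` {1..k}"
    by (auto simp: A_tree_def)
  then show ?thesis
    using arm[of VA n] arm[of VB m] arm[of VC k]
    by (simp only: A_tree_def weighted_graph.simps image_Un parent.simps simp_thms HOL.refl)
qed

lemma parent_A_tree:
  assumes "v \<in> verts (A_tree n m k)" "v \<noteq> E0"
  shows "parent v \<in> verts (A_tree n m k)" "depth v = Suc (depth (parent v))"
  using assms by (cases v; auto simp: A_tree_def image_iff)+

lemma weighted_tree_A_tree: "weighted_tree (A_tree n m k)"
proof -
  let ?G = "A_tree n m k"
  have to_root: "(v, E0) \<in> (adj_rel ?G)\<^sup>*" if "v \<in> verts ?G" for v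
    using that
  proof (induction "depth v" arbitrary: v rule: less_induct)
    case less
    show ?case
    proof (cases "v = E0")
      case False
      then have "(v, parent v) \<in> adj_rel ?G"
        using less.prems by (auto simp: adj_rel_def edges_A_tree insert_commute)
      moreover have "(parent v, E0) \<in> (adj_rel ?G)\<^sup>*"
        using less False parent_A_tree by (metis lessI)
      ultimately show ?thesis by (rule converse_rtrancl_into_rtrancl)
    qed simp
  qed
  have sym: "sym (adj_rel ?G)"
    by (auto simp: sym_def adj_rel_def insert_commute)
  have "(u, v) \<in> (adj_rel ?G)\<^sup>*" if "u \<in> verts ?G" "v \<in> verts ?G" for u v
    using to_root[OF that(1)] symD[OF sym_rtrancl[OF sym] to_root[OF that(2)]] by (rule rtrancl_trans)
  moreover have "e \<subseteq> verts ?G \<and> card e = 2" if e: "e \<in> edges ?G" for e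
  proof -
    obtain v where v: "e = {parent v, v}" "v \<in> verts ?G" "v \<noteq> E0"
      using e unfolding edges_A_tree by blast
    then have "parent v \<noteq> v" using parent_A_tree(2) by fastforce
    then show ?thesis using v parent_A_tree(1) by auto
  qed
  moreover have False if "is_cycle ?G xs" for xs
  proof -
    let ?l = "length xs"
    have l: "3 \<le> ?l" and d: "distinct xs"
      and e: "\<And>i. i < ?l \<Longrightarrow> {xs ! i, xs ! (Suc i mod ?l)} \<in> edges ?G"
      using that by (auto simp: is_cycle_def)
    have low: "u = parent v" if uv: "{u, v} \<in> edges ?G" "depth u \<le> depth v" for u v
    proof -
      obtain w where w: "{u, v} = {parent w, w}" "w \<in> verts ?G" "w \<noteq> E0"
        using uv(1) unfolding edges_A_tree by blast
      with parent_A_tree(2)[OF w(2,3)] uv(2) show ?thesis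
        by (metis Suc_n_not_le_n doubleton_eq_iff)
    qed
    have "\<exists>i<?l. \<forall>j<?l. depth (xs ! j) \<le> depth (xs ! i)"
    proof -
      have "Max ((\<lambda>i. depth (xs ! i)) ` {..<?l}) \<in> (\<lambda>i. depth (xs ! i)) ` {..<?l}"
        using l by (intro Max_in) (auto simp: lessThan_empty_iff)
      then obtain i where "i < ?l" "Max ((\<lambda>i. depth (xs ! i)) ` {..<?l}) = depth (xs ! i)"
        by auto
      then show ?thesis
        by (metis (no_types, lifting) Max_ge finite_imageI finite_lessThan image_eqI lessThan_iff)
    qed
    then obtain i where i: "i < ?l" "\<And>j. j < ?l \<Longrightarrow> depth (xs ! j) \<le> depth (xs ! i)"
      by blast
    define s where "s = Suc i mod ?l"
    define p where "p = (if i = 0 then ?l - 1 else i - 1)"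
    have s: "s < ?l" and p: "p < ?l" and ps: "Suc p mod ?l = i"
      using i(1) l by (auto simp: s_def p_def intro!: mod_less_divisor)
    have "s \<noteq> p"
      using i(1) l by (cases "Suc i = ?l") (auto simp: s_def p_def)
    have "xs ! s = parent (xs ! i)"
      using e[OF i(1)] i(2)[OF s] low by (simp add: s_def insert_commute)
    moreover have "xs ! p = parent (xs ! i)"
      using e[OF p] i(2)[OF p] low ps by simp
    ultimately show False
      using d s p \<open>s \<noteq> p\<close> nth_eq_iff_index_eq by metis
  qed
  ultimately show ?thesis
    unfolding weighted_tree_def by (auto simp: A_tree_def)
qed

end

theory Submission
  imports Defs
begin

text \<open>
  Let \<open>e\<close> be the coefficient of \<open>E\<^sub>0\<close> in \<open>Y\<close>. Completing squares along the arms shows that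
  \<open>- (Y \<cdot> Y)\<close> is the sum of the squared differences of consecutive coefficients along the three
  arms, each arm being read as a sequence from \<open>e\<close> to \<open>0\<close>; the weight \<open>3\<close> of \<open>E\<^sub>0\<close> provides one
  \<open>e\<^sup>2\<close> per arm. The contribution of an arm, its energy, is at least \<open>\<bar>e\<bar>\<close> and congruent to \<open>e\<close> modulo \<open>2\<close>, so a
  total of \<open>2\<close> or \<open>3\<close> leaves two possibilities: \<open>e = 0\<close>, with energy \<open>2\<close> on one arm and \<open>0\<close> on the
  other two, or \<open>e = \<plusminus>1\<close>, with energy \<open>1\<close> on every arm. In both cases the coefficients
  automatically have a common sign. Removing the first step of a sequence gives recurrences
  that count \<open>n\<^sup>2 + n\<close> sequences of energy \<open>2\<close> from \<open>0\<close> and \<open>n + 1\<close> of energy \<open>1\<close> from \<open>\<plusminus>1\<close>.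
\<close>

section \<open>Integer sequences of small energy\<close>

definition energy :: "nat \<Rightarrow> (nat \<Rightarrow> int) \<Rightarrow> int" where
  "energy n x = (\<Sum>i\<le>n. (x i - x (Suc i))\<^sup>2)"

text \<open>Vanishing beyond \<open>n\<close> leaves only finitely many free entries, so these sets
  can be counted. The last step that \<open>energy n\<close> measures is the drop from
  \<open>x n\<close> to \<open>x (Suc n) = 0\<close>.\<close>

definition walks :: "nat \<Rightarrow> int \<Rightarrow> int \<Rightarrow> (nat \<Rightarrow> int) set" where
  "walks n e d = {x. x 0 = e \<and> (\<forall>i>n. x i = 0) \<and> energy n x = d}"

lemma energy_Suc: "energy (Suc n) x = (x 0 - x 1)\<^sup>2 + energy n (x \<circ> Suc)"
  unfolding energy_def by (subst sum.atMost_Suc_shift) simp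

lemma abs_le_square_int: "\<bar>z\<bar> \<le> z\<^sup>2" for z :: int
proof (cases "z = 0")
  case False
  then have "\<bar>z\<bar> * 1 \<le> \<bar>z\<bar> * \<bar>z\<bar>" by (intro mult_left_mono) auto
  then show ?thesis by (simp add: power2_eq_square)
qed simp

text \<open>Triangle inequality: the square of each integer step is at least its absolute
  value.\<close>

lemma abs_diff_le_energy: "\<bar>x 0 - x (Suc n)\<bar> \<le> energy n x"
proof (induction n)
  case 0
  then show ?case by (simp add: energy_def abs_le_square_int)
next
  case (Suc n)
  then show ?case
    using abs_le_square_int[of "x (Suc n) - x (Suc (Suc n))"] by (simp add: energy_def)
qed

text \<open>An integer and its square have the same parity, so the sum of squares telescopes modulo
  2.\<close>

lemma even_energy_iff: "even (energy n x) \<longleftrightarrow> even (x 0 - x (Suc n))"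
  by (induction n) (auto simp: energy_def)

lemma energy_expand:
  "energy n x = (x 0)\<^sup>2 + (\<Sum>i=1..n. 2 * (x i)\<^sup>2 - 2 * x (i - 1) * x i)
     + (x (Suc n))\<^sup>2 - 2 * x n * x (Suc n)"
  by (induction n) (simp_all add: energy_def power2_eq_square algebra_simps)

lemma walks_start: "x \<in> walks n e d \<Longrightarrow> x 0 = e"
  by (simp add: walks_def)

lemma walks_empty: "d < \<bar>e\<bar> \<Longrightarrow> walks n e d = {}"
proof (rule ccontr)
  assume "d < \<bar>e\<bar>" "walks n e d \<noteq> {}"
  then obtain x where "x \<in> walks n e d" by blast
  with abs_diff_le_energy[of x n] \<open>d < \<bar>e\<bar>\<close> show False by (simp add: walks_def)
qed

lemma walks_0: "walks 0 e d = (if d = e\<^sup>2 then {\<lambda>i. if i = 0 then e else 0} else {})"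
proof -
  have "x \<in> walks 0 e d \<longleftrightarrow> d = e\<^sup>2 \<and> x = (\<lambda>i. if i = 0 then e else 0)" for x
  proof -
    have "x = (\<lambda>i. if i = 0 then e else 0) \<longleftrightarrow> x 0 = e \<and> (\<forall>i>0. x i = 0)"
      by (metis gr0I less_irrefl)
    then show ?thesis by (auto simp: walks_def energy_def)
  qed
  then show ?thesis by auto
qed

section \<open>Recurrences by the first step\<close>

lemma walks_Suc_iff:
  "x \<in> walks (Suc n) e d \<longleftrightarrow> x 0 = e \<and> x \<circ> Suc \<in> walks n (x 1) (d - (e - x 1)\<^sup>2)"
proof -
  have "(\<forall>i>Suc n. x i = 0) \<longleftrightarrow> (\<forall>i>n. x (Suc i) = 0)"
    by (metis Suc_less_eq2 Suc_less_eq)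
  then show ?thesis by (auto simp: walks_def energy_Suc)
qed

text \<open>A first step to \<open>f\<close> costs \<open>(e - f)\<^sup>2\<close>, and the tail
  needs at least the absolute value of \<open>f\<close> to come down to 0. Further elements of
  \<open>F\<close> contribute only empty sets.\<close>

lemma walks_Suc:
  assumes "\<And>f. (e - f)\<^sup>2 + \<bar>f\<bar> \<le> d \<Longrightarrow> f \<in> F"
  shows "walks (Suc n) e d = case_nat e ` (\<Union>f\<in>F. walks n f (d - (e - f)\<^sup>2))"
proof (intro set_eqI iffI)
  fix x assume x: "x \<in> walks (Suc n) e d"
  then have tl: "x \<circ> Suc \<in> walks n (x 1) (d - (e - x 1)\<^sup>2)" and hd: "x 0 = e"
    by (simp_all add: walks_Suc_iff)
  then have "\<not> d - (e - x 1)\<^sup>2 < \<bar>x 1\<bar>"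
    using walks_empty by blast
  then have "x 1 \<in> F" by (intro assms) simp
  moreover have "x = case_nat e (x \<circ> Suc)"
    using hd by (auto simp: fun_eq_iff split: nat.split)
  ultimately show "x \<in> case_nat e ` (\<Union>f\<in>F. walks n f (d - (e - f)\<^sup>2))"
    using tl by blast
next
  fix x assume "x \<in> case_nat e ` (\<Union>f\<in>F. walks n f (d - (e - f)\<^sup>2))"
  then show "x \<in> walks (Suc n) e d"
    by (auto simp: walks_Suc_iff comp_def walks_start)
qed

lemma inj_case_nat: "inj_on (case_nat e) A"
proof (rule inj_onI)
  fix x y assume eq: "case_nat e x = case_nat e y"
  show "x = y"
  proof
    fix i show "x i = y i" using fun_cong[OF eq, of "Suc i"] by simp
  qed
qed

lemma walks_0_0: "walks n 0 0 = {\<lambda>_. 0}"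
proof (induction n)
  case 0
  then show ?case by (auto simp: walks_0)
next
  case (Suc n)
  have "walks (Suc n) 0 0 = case_nat 0 ` (\<Union>f\<in>{0}. walks n f (0 - (0 - f)\<^sup>2))"
    by (rule walks_Suc) (smt (verit) abs_le_square_int singletonI zero_le_power2)
  then show ?case using Suc by (auto simp: fun_eq_iff split: nat.split)
qed

text \<open>The budget 1 keeps the next entry between \<open>0\<close> and \<open>s\<close>: the
  sequence either stays at \<open>s\<close> or spends everything on the drop to 0.\<close>

lemma walks_unit_Suc:
  assumes "\<bar>s\<bar> = 1"
  shows "walks (Suc n) s 1 = case_nat s ` (walks n s 1 \<union> walks n 0 0)"
proof -
  have "walks (Suc n) s 1 = case_nat s ` (\<Union>f\<in>{s, 0}. walks n f (1 - (s - f)\<^sup>2))"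
  proof (rule walks_Suc)
    fix f assume "(s - f)\<^sup>2 + \<bar>f\<bar> \<le> 1"
    with abs_le_square_int[of "s - f"] assms show "f \<in> {s, 0}" by (cases "f = 2 * s") auto
  qed
  moreover have "s\<^sup>2 = 1" using assms by (metis power2_abs one_power2)
  ultimately show ?thesis by simp
qed

text \<open>Staying at 0 keeps the budget 2; a step to 1 or -1 leaves just the one unit needed for
  the return.\<close>

lemma walks_0_2_Suc:
  "walks (Suc n) 0 2 = case_nat 0 ` (walks n 0 2 \<union> (walks n 1 1 \<union> walks n (- 1) 1))"
proof -
  have "walks (Suc n) 0 2 = case_nat 0 ` (\<Union>f\<in>{0, 1, - 1}. walks n f (2 - (0 - f)\<^sup>2))"
  proof (rule walks_Suc)
    fix f :: int assume "(0 - f)\<^sup>2 + \<bar>f\<bar> \<le> 2"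
    with abs_le_square_int[of f] show "f \<in> {0, 1, - 1}" by auto
  qed
  then show ?thesis by simp
qed

section \<open>Cardinalities and signs\<close>

lemma walks_disjoint: "e \<noteq> f \<Longrightarrow> walks n e d \<inter> walks n f d' = {}"
  by (auto simp: walks_def)

lemma card_walks_unit:
  assumes "\<bar>s\<bar> = 1"
  shows "finite (walks n s 1) \<and> card (walks n s 1) = n + 1"
proof (induction n)
  case 0
  have "s\<^sup>2 = 1" using assms by (metis power2_abs one_power2)
  then show ?case by (simp add: walks_0)
next
  case (Suc n)
  have "walks n s 1 \<inter> walks n 0 0 = {}" using assms by (intro walks_disjoint) auto
  with Suc show ?case
    by (simp add: walks_unit_Suc[OF assms] card_image[OF inj_case_nat] card_Un_disjoint walks_0_0
        del: Un_insert_right)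
qed

text \<open>The two families of unit walks add \<open>2 * (n + 1)\<close>, which is the increment of
  \<open>n\<^sup>2 + n\<close>.\<close>

lemma card_walks_0_2: "finite (walks n 0 2) \<and> card (walks n 0 2) = n\<^sup>2 + n"
proof (induction n)
  case 0
  then show ?case by (simp add: walks_0)
next
  case (Suc n)
  have "walks n 0 2 \<inter> (walks n 1 1 \<union> walks n (- 1) 1) = {}" "walks n 1 1 \<inter> walks n (- 1) 1 = {}"
    by (auto simp: walks_def)
  with Suc card_walks_unit[of 1 n] card_walks_unit[of "- 1" n] show ?case
    by (simp add: walks_0_2_Suc card_image[OF inj_case_nat] card_Un_disjoint power2_eq_square)
qed

text \<open>The recurrence shows that all entries are \<open>s\<close> or \<open>0\<close>; the
  factor \<open>s\<close> treats both signs at once.\<close>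

lemma walks_unit_sign: "x \<in> walks n s 1 \<Longrightarrow> \<bar>s\<bar> = 1 \<Longrightarrow> 0 \<le> s * x i"
proof (induction n arbitrary: x i)
  case 0
  then show ?case by (auto simp: walks_0 split: if_splits)
next
  case (Suc n)
  then show ?case by (auto simp: walks_unit_Suc walks_0_0 split: nat.split)
qed

lemma walks_0_2_sign: "x \<in> walks n 0 2 \<Longrightarrow> (\<forall>i. 0 \<le> x i) \<or> (\<forall>i. x i \<le> 0)"
proof (induction n arbitrary: x)
  case 0
  then show ?case by (simp add: walks_0)
next
  case (Suc n)
  then obtain y where x: "x = case_nat 0 y"
    and y: "y \<in> walks n 0 2 \<or> y \<in> walks n 1 1 \<or> y \<in> walks n (- 1) 1"
    by (auto simp: walks_0_2_Suc)
  from y have "(\<forall>i. 0 \<le> y i) \<or> (\<forall>i. y i \<le> 0)"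
    using Suc.IH walks_unit_sign[of y n 1] walks_unit_sign[of y n "- 1"] by auto
  then show ?case by (auto simp: x split: nat.split)
qed

section \<open>The intersection form of the tree\<close>

text \<open>Index 0 stands for \<open>E0\<close> on every arm, so the non-vertex \<open>f 0\<close>
  is never read.\<close>

definition arm :: "(nat \<Rightarrow> vertex) \<Rightarrow> (vertex \<Rightarrow>\<^sub>0 int) \<Rightarrow> nat \<Rightarrow> int" where
  "arm f Y i = (if i = 0 then Poly_Mapping.lookup Y E0 else Poly_Mapping.lookup Y (f i))"

lemma arm_0: "arm f Y 0 = Poly_Mapping.lookup Y E0"
  by (simp add: arm_def)

lemma finite_verts_A_tree: "finite (verts (A_tree n m k))"
  by (simp add: A_tree_def)

text \<open>The three conditions exclude each other because depth grows by one from parent to child;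
  the nested conditional thus becomes a sum that can be evaluated term by term.\<close>

lemma vertex_form_A_tree:
  fixes n m k :: nat
  defines "G \<equiv> A_tree n m k"
  assumes "u \<in> verts G" "v \<in> verts G"
  shows "vertex_form G u v = (if u = v then - weight G v else 0)
    + (if v \<noteq> E0 \<and> u = parent v then 1 else 0) + (if u \<noteq> E0 \<and> v = parent u then 1 else 0)"
proof -
  define p where "p \<longleftrightarrow> v \<noteq> E0 \<and> u = parent v"
  define q where "q \<longleftrightarrow> u \<noteq> E0 \<and> v = parent u"
  have "{u, v} \<in> edges G \<longleftrightarrow> p \<or> q"
    using assms by (auto simp: edges_A_tree doubleton_eq_iff image_iff insert_commute p_def q_def)
  moreover have "p \<Longrightarrow> depth v = Suc (depth u)" "q \<Longrightarrow> depth u = Suc (depth v)"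
    using assms parent_A_tree(2) unfolding p_def q_def by blast+
  then have "p \<Longrightarrow> \<not> q \<and> u \<noteq> v" "q \<Longrightarrow> u \<noteq> v"
    by fastforce+
  ultimately show ?thesis
    unfolding p_def[symmetric] q_def[symmetric] vertex_form_def by (cases p; cases q) simp_all
qed

text \<open>In the tree rooted at \<open>E0\<close>, edges correspond to the vertices other than the
  root, each joined to its parent.\<close>

lemma intersection_form_A_tree_parent:
  fixes n m k :: nat and Y :: "vertex \<Rightarrow>\<^sub>0 int"
  defines "G \<equiv> A_tree n m k" and "y \<equiv> Poly_Mapping.lookup Y"
  shows "intersection_form G Y Y =
    - (3 * (y E0)\<^sup>2 + (\<Sum>v\<in>verts G - {E0}. 2 * (y v)\<^sup>2 - 2 * y (parent v) * y v))"
proof -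
  let ?V = "verts G"
  have fin: "finite ?V" by (simp add: G_def finite_verts_A_tree)
  have E0: "E0 \<in> ?V" by (simp add: G_def A_tree_def)
  have up: "(\<Sum>u\<in>?V. if v \<noteq> E0 \<and> u = parent v then y u * y v else 0) =
      (if v = E0 then 0 else y (parent v) * y v)" if "v \<in> ?V" for v
    using that fin parent_A_tree(1)[of v n m k] by (cases "v = E0") (simp_all add: G_def)
  have edge: "(\<Sum>v\<in>?V. \<Sum>u\<in>?V. if v \<noteq> E0 \<and> u = parent v then y u * y v else 0) =
      (\<Sum>v\<in>?V - {E0}. y (parent v) * y v)"
  proof -
    have "(\<Sum>v\<in>?V. \<Sum>u\<in>?V. if v \<noteq> E0 \<and> u = parent v then y u * y v else 0) =
        (\<Sum>v\<in>?V. if v = E0 then 0 else y (parent v) * y v)"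
      by (intro sum.cong refl up)
    also have "\<dots> = (\<Sum>v\<in>?V - {E0}. y (parent v) * y v)"
      by (subst sum.remove[OF fin E0]) (auto intro!: sum.cong)
    finally show ?thesis .
  qed
  have "intersection_form G Y Y = (\<Sum>u\<in>?V. \<Sum>v\<in>?V. (if u = v then - weight G v * (y v)\<^sup>2 else 0)
      + (if v \<noteq> E0 \<and> u = parent v then y u * y v else 0)
      + (if u \<noteq> E0 \<and> v = parent u then y v * y u else 0))"
    unfolding intersection_form_def
    by (intro sum.cong refl)
      (simp add: y_def G_def vertex_form_A_tree algebra_simps power2_eq_square)
  also have "\<dots> = (\<Sum>u\<in>?V. - weight G u * (y u)\<^sup>2)
      + (\<Sum>u\<in>?V. \<Sum>v\<in>?V. if v \<noteq> E0 \<and> u = parent v then y u * y v else 0)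
      + (\<Sum>v\<in>?V - {E0}. y (parent v) * y v)"
    unfolding sum.distrib by (simp add: sum.delta[OF fin] sum.delta'[OF fin] edge)
  \<comment> \<open>Both orientations of an edge contribute equally, hence the factor 2.\<close>
  also have "\<dots> = (\<Sum>u\<in>?V. - weight G u * (y u)\<^sup>2) + 2 * (\<Sum>v\<in>?V - {E0}. y (parent v) * y v)"
    by (subst sum.swap) (subst edge, simp)
  also have "(\<Sum>u\<in>?V. - weight G u * (y u)\<^sup>2) = - 3 * (y E0)\<^sup>2 - (\<Sum>v\<in>?V - {E0}. 2 * (y v)\<^sup>2)"
    by (subst sum.remove[OF fin E0])
      (simp add: G_def A_tree_def sum_negf[symmetric] cong: sum.cong_simp)
  finally show ?thesis
    by (simp add: sum_subtractf sum_distrib_left mult.assoc)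
qed

lemma arm_beyond:
  assumes "Y \<in> divisor_group (A_tree n m k)"
  shows "n < i \<Longrightarrow> arm VA Y i = 0" "m < i \<Longrightarrow> arm VB Y i = 0" "k < i \<Longrightarrow> arm VC Y i = 0"
proof -
  have zero: "Poly_Mapping.lookup Y v = 0" if "v \<notin> verts (A_tree n m k)" for v
    using assms that by (auto simp: divisor_group_def in_keys_iff)
  show "n < i \<Longrightarrow> arm VA Y i = 0" "m < i \<Longrightarrow> arm VB Y i = 0" "k < i \<Longrightarrow> arm VC Y i = 0"
    by (auto simp: arm_def A_tree_def intro!: zero)
qed

lemma energy_arm:
  assumes "inj f" "\<And>i. parent (f i) = (if i = 1 then E0 else f (i - 1))" "arm f Y (Suc n) = 0"
  shows "energy n (arm f Y) = (Poly_Mapping.lookup Y E0)\<^sup>2 +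
    (\<Sum>v\<in>f ` {1..n}. 2 * (Poly_Mapping.lookup Y v)\<^sup>2
       - 2 * Poly_Mapping.lookup Y (parent v) * Poly_Mapping.lookup Y v)"
proof -
  have "inj_on f {1..n}" using assms(1) by (rule inj_on_subset) simp
  moreover have "(\<Sum>i=1..n. 2 * (arm f Y i)\<^sup>2 - 2 * arm f Y (i - 1) * arm f Y i) =
    (\<Sum>i=1..n. 2 * (Poly_Mapping.lookup Y (f i))\<^sup>2
       - 2 * Poly_Mapping.lookup Y (parent (f i)) * Poly_Mapping.lookup Y (f i))"
    by (intro sum.cong refl) (auto simp: arm_def assms(2))
  ultimately show ?thesis
    using assms(3) by (simp add: energy_expand sum.reindex) (simp add: arm_def)
qed

lemma intersection_form_A_tree:
  assumes "Y \<in> divisor_group (A_tree n m k)"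
  shows "intersection_form (A_tree n m k) Y Y =
    - (energy n (arm VA Y) + energy m (arm VB Y) + energy k (arm VC Y))"
proof -
  have V: "verts (A_tree n m k) - {E0} = VA ` {1..n} \<union> (VB ` {1..m} \<union> VC ` {1..k})"
    by (auto simp: A_tree_def)
  have "VA ` {1..n} \<inter> (VB ` {1..m} \<union> VC ` {1..k}) = {}" "VB ` {1..m} \<inter> VC ` {1..k} = {}"
    by auto
  then show ?thesis
    unfolding intersection_form_A_tree_parent V
    using arm_beyond[OF assms]
    by (simp add: sum.union_disjoint energy_arm inj_def del: One_nat_def)
qed

section \<open>Roots as triples of walks\<close>

text \<open>The first three pieces have \<open>e = 0\<close> and differ in the arm that carries the
  energy; the last two have \<open>e = 1\<close> and \<open>e = - 1\<close>. The factors of each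
  piece share their start, so the arms agree at \<open>E0\<close>.\<close>

definition root_walks ::
    "nat \<Rightarrow> nat \<Rightarrow> nat \<Rightarrow> ((nat \<Rightarrow> int) \<times> (nat \<Rightarrow> int) \<times> (nat \<Rightarrow> int)) set" where
  "root_walks n m k =
     (walks n 0 2 \<times> walks m 0 0 \<times> walks k 0 0) \<union>
     ((walks n 0 0 \<times> walks m 0 2 \<times> walks k 0 0) \<union>
     ((walks n 0 0 \<times> walks m 0 0 \<times> walks k 0 2) \<union>
     ((walks n 1 1 \<times> walks m 1 1 \<times> walks k 1 1) \<union>
      (walks n (- 1) 1 \<times> walks m (- 1) 1 \<times> walks k (- 1) 1))))"

lemma card_root_walks:
  "card (root_walks n m k) =
     n\<^sup>2 + m\<^sup>2 + k\<^sup>2 + n + m + k + 2 * (n + 1) * (m + 1) * (k + 1)"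
proof -
  have disj: "walks l 0 2 \<inter> walks l 0 0 = {}" "walks l 0 0 \<inter> walks l 0 2 = {}"
    "walks l 0 2 \<inter> walks l 1 1 = {}" "walks l 0 2 \<inter> walks l (- 1) 1 = {}"
    "walks l 0 0 \<inter> walks l 1 1 = {}" "walks l 0 0 \<inter> walks l (- 1) 1 = {}"
    "walks l 1 1 \<inter> walks l (- 1) 1 = {}" for l
    by (auto simp: walks_def)
  have fin: "finite (walks l 0 0)" "finite (walks l 0 2)" "finite (walks l 1 1)"
    "finite (walks l (- 1) 1)" for l
    using card_walks_0_2 card_walks_unit[of 1 l] card_walks_unit[of "- 1" l]
    by (simp_all add: walks_0_0)
  have card: "card (walks l 0 0) = 1" "card (walks l 0 2) = l\<^sup>2 + l" "card (walks l 1 1) = l + 1"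
    "card (walks l (- 1) 1) = l + 1" for l
    using card_walks_0_2 card_walks_unit[of 1 l] card_walks_unit[of "- 1" l]
    by (simp_all add: walks_0_0)
  show ?thesis
    unfolding root_walks_def
    by (simp add: card_Un_disjoint fin card disj Int_Un_distrib Times_Int_Times card_cartesian_product
        del: One_nat_def) (simp add: algebra_simps)
qed

lemma root_walks_iff:
  assumes "a 0 = e" "b 0 = e" "c 0 = e"
    and "\<And>i. n < i \<Longrightarrow> a i = 0" "\<And>i. m < i \<Longrightarrow> b i = 0" "\<And>i. k < i \<Longrightarrow> c i = 0"
  shows "(a, b, c) \<in> root_walks n m k \<longleftrightarrow> energy n a + energy m b + energy k c \<in> {2, 3}"
proof -
  have bounds: "\<bar>e\<bar> \<le> energy n a" "\<bar>e\<bar> \<le> energy m b" "\<bar>e\<bar> \<le> energy k c"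
    using abs_diff_le_energy[of a n] abs_diff_le_energy[of b m] abs_diff_le_energy[of c k] assms
    by simp_all
  have parity: "even (energy n a) \<longleftrightarrow> even e" "even (energy m b) \<longleftrightarrow> even e"
    "even (energy k c) \<longleftrightarrow> even e"
    using assms by (simp_all add: even_energy_iff)
  have "(a, b, c) \<in> root_walks n m k \<longleftrightarrow>
    e = 0 \<and> (energy n a = 2 \<and> energy m b = 0 \<and> energy k c = 0
      \<or> energy n a = 0 \<and> energy m b = 2 \<and> energy k c = 0
      \<or> energy n a = 0 \<and> energy m b = 0 \<and> energy k c = 2)
    \<or> (e = 1 \<or> e = - 1) \<and> energy n a = 1 \<and> energy m b = 1 \<and> energy k c = 1"
    (is "_ \<longleftrightarrow> ?roots")
    using assms by (auto simp: root_walks_def walks_def)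
  also have "\<dots> \<longleftrightarrow> energy n a + energy m b + energy k c \<in> {2, 3}"
  proof (intro iffI)
    assume total: "energy n a + energy m b + energy k c \<in> {2, 3}"
    then have "\<bar>e\<bar> \<le> 1" using bounds by auto
    then consider "e = 0" | "e = 1 \<or> e = - 1" by linarith
    then show "?roots"
    proof cases
      case 1
      with parity obtain p q r where "energy n a = 2 * p" "energy m b = 2 * q" "energy k c = 2 * r"
        by (metis even_zero evenE)
      \<comment> \<open>All three energies are even here, which rules out the total 3; the halves
        then sum to 1.\<close>
      moreover from this have "0 \<le> p" "0 \<le> q" "0 \<le> r" "p + q + r = 1"
        using bounds total by auto
      ultimately show ?thesis using 1 by auto
    next
      \<comment> \<open>Each energy is at least 1 and the total at most 3, so all three equal
        1.\<close>
      case 2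
      with bounds total show ?thesis by auto
    qed
  qed auto
  finally show ?thesis .
qed

text \<open>If \<open>e = 0\<close>, only one arm is non-zero and it has constant sign; otherwise
  all arms take the sign of \<open>e\<close>.\<close>

lemma root_walks_sign:
  assumes "(a, b, c) \<in> root_walks n m k"
  shows "(\<forall>i. 0 \<le> a i \<and> 0 \<le> b i \<and> 0 \<le> c i) \<or> (\<forall>i. a i \<le> 0 \<and> b i \<le> 0 \<and> c i \<le> 0)"
proof -
  have pos: "0 \<le> x i" if "x \<in> walks l 1 1" for x l i
    using walks_unit_sign[OF that] by simp
  have neg: "x i \<le> 0" if "x \<in> walks l (- 1) 1" for x l i
    using walks_unit_sign[OF that] by simp
  consider "a \<in> walks n 0 2" "b = (\<lambda>_. 0)" "c = (\<lambda>_. 0)"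
    | "a = (\<lambda>_. 0)" "b \<in> walks m 0 2" "c = (\<lambda>_. 0)"
    | "a = (\<lambda>_. 0)" "b = (\<lambda>_. 0)" "c \<in> walks k 0 2"
    | "a \<in> walks n 1 1" "b \<in> walks m 1 1" "c \<in> walks k 1 1"
    | "a \<in> walks n (- 1) 1" "b \<in> walks m (- 1) 1" "c \<in> walks k (- 1) 1"
    using assms unfolding root_walks_def walks_0_0 by blast
  then show ?thesis
  proof cases
    case 1
    then show ?thesis using walks_0_2_sign[of a n] by simp
  next
    case 2
    then show ?thesis using walks_0_2_sign[of b m] by simp
  next
    case 3
    then show ?thesis using walks_0_2_sign[of c k] by simp
  next
    case 4
    then show ?thesis using pos by blast
  next
    case 5
    then show ?thesis using neg by blast
  qed
qed

text \<open>The sign condition on a root follows from the value of the form, so only the energies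
  matter.\<close>

lemma triple_root_system_A_tree_iff:
  "Y \<in> triple_root_system (A_tree n m k) \<longleftrightarrow>
     Y \<in> divisor_group (A_tree n m k) \<and> (arm VA Y, arm VB Y, arm VC Y) \<in> root_walks n m k"
proof (cases "Y \<in> divisor_group (A_tree n m k)")
  case True
  let ?G = "A_tree n m k"
  let ?a = "arm VA Y" and ?b = "arm VB Y" and ?c = "arm VC Y"
  have rw: "(?a, ?b, ?c) \<in> root_walks n m k \<longleftrightarrow>
      intersection_form ?G Y Y = -2 \<or> intersection_form ?G Y Y = -3"
    unfolding intersection_form_A_tree[OF True]
    by (subst root_walks_iff[where e = "Poly_Mapping.lookup Y E0"])
      (auto simp: arm_beyond[OF True] arm_0)
  have "positive_divisor ?G Y \<or> negative_divisor ?G Y" if "(?a, ?b, ?c) \<in> root_walks n m k"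
  proof -
    have "Y \<noteq> 0"
      using that unfolding rw by (auto simp: intersection_form_def)
    moreover have val: "\<exists>i. Poly_Mapping.lookup Y v \<in> {?a i, ?b i, ?c i}" if "v \<in> verts ?G" for v
    proof (cases v)
      case E0
      then show ?thesis by (intro exI[of _ 0]) (simp add: arm_def)
    next
      case (VA i)
      then show ?thesis using that by (intro exI[of _ i]) (auto simp: arm_def A_tree_def)
    next
      case (VB i)
      then show ?thesis using that by (intro exI[of _ i]) (auto simp: arm_def A_tree_def)
    next
      case (VC i)
      then show ?thesis using that by (intro exI[of _ i]) (auto simp: arm_def A_tree_def)
    qed
    ultimately show ?thesis
      using root_walks_sign[OF that] True unfolding positive_divisor_def negative_divisor_def
      by (metis insertE singletonD)
  qed
  then show ?thesis using True rw by (auto simp: triple_root_system_def)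
qed (auto simp: triple_root_system_def positive_divisor_def negative_divisor_def)

section \<open>Divisors and triples of arms\<close>

lemma divisor_of_arms:
  assumes "a 0 = e" "b 0 = e" "c 0 = e"
    and "\<And>i. n < i \<Longrightarrow> a i = 0" "\<And>i. m < i \<Longrightarrow> b i = 0" "\<And>i. k < i \<Longrightarrow> c i = 0"
  obtains Y where "Y \<in> divisor_group (A_tree n m k)" "arm VA Y = a" "arm VB Y = b" "arm VC Y = c"
proof -
  let ?V = "verts (A_tree n m k)"
  \<comment> \<open>The common start \<open>e\<close> gives a single value at \<open>E0\<close>; the
    default 0 covers indices outside the tree, including index 0 of the arm constructors.\<close>
  define g where "g v = (if v \<in> ?V then (case v of E0 \<Rightarrow> e | VA i \<Rightarrow> a i | VB i \<Rightarrow> b i | VC i \<Rightarrow> c i)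
    else 0)" for v
  have "{v. g v \<noteq> 0} \<subseteq> ?V" by (auto simp: g_def)
  then have fin: "finite {v. g v \<noteq> 0}" by (rule finite_subset) (rule finite_verts_A_tree)
  define Y where "Y = Abs_poly_mapping g"
  have Y: "Poly_Mapping.lookup Y = g" unfolding Y_def using fin by (rule lookup_Abs_poly_mapping)
  show thesis
  proof
    show "Y \<in> divisor_group (A_tree n m k)"
      using \<open>{v. g v \<noteq> 0} \<subseteq> ?V\<close> by (auto simp: divisor_group_def in_keys_iff Y)
    show "arm VA Y = a" "arm VB Y = b" "arm VC Y = c"
      using assms by (auto simp: fun_eq_iff arm_def Y g_def A_tree_def image_iff not_le)
  qed
qed

lemma arms_inj_on:
  "inj_on (\<lambda>Y. (arm VA Y, arm VB Y, arm VC Y)) (divisor_group (A_tree n m k))"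
proof (rule inj_onI, rule poly_mapping_eqI)
  fix Y Z v
  assume Y: "Y \<in> divisor_group (A_tree n m k)" and Z: "Z \<in> divisor_group (A_tree n m k)"
    and eq: "(arm VA Y, arm VB Y, arm VC Y) = (arm VA Z, arm VB Z, arm VC Z)"
  \<comment> \<open>The coefficient at a vertex is the entry of its own arm at index
    \<open>depth v\<close>.\<close>
  have arms: "arm VA Y (depth v) = arm VA Z (depth v)" "arm VB Y (depth v) = arm VB Z (depth v)"
    "arm VC Y (depth v) = arm VC Z (depth v)"
    using eq by simp_all
  show "Poly_Mapping.lookup Y v = Poly_Mapping.lookup Z v"
  proof (cases "v \<in> verts (A_tree n m k)")
    case True
    then show ?thesis using arms by (cases v) (auto simp: arm_def A_tree_def)
  next
    case False
    then show ?thesis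
      using Y Z by (metis (no_types, lifting) divisor_group_def in_keys_iff mem_Collect_eq subsetD)
  qed
qed

theorem proposition3p14:
  fixes n m k :: nat
  shows "card (triple_root_system (A_tree n m k)) =
    n^2 + m^2 + k^2 + n + m + k + 2 * (n + 1) * (m + 1) * (k + 1)"
proof -
  let ?R = "triple_root_system (A_tree n m k)"
  let ?arms = "\<lambda>Y. (arm VA Y, arm VB Y, arm VC Y)"
  have "inj_on ?arms ?R"
    using arms_inj_on by (rule inj_on_subset) (auto simp: triple_root_system_A_tree_iff)
  then have "card (?arms ` ?R) = card ?R" by (rule card_image)
  moreover have "?arms ` ?R = root_walks n m k"
  proof (intro equalityI subsetI)
    fix t assume t: "t \<in> root_walks n m k"
    obtain a b c where abc: "t = (a, b, c)" by (cases t)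
    have "b 0 = a 0" "c 0 = a 0" "\<And>i. n < i \<Longrightarrow> a i = 0" "\<And>i. m < i \<Longrightarrow> b i = 0"
      "\<And>i. k < i \<Longrightarrow> c i = 0"
      using t by (auto simp: abc root_walks_def walks_def)
    then obtain Y where "Y \<in> divisor_group (A_tree n m k)" "?arms Y = t"
      using divisor_of_arms[of a "a 0" b c n m k] abc by metis
    then show "t \<in> ?arms ` ?R"
      using t by (intro image_eqI[of _ _ Y]) (simp_all add: triple_root_system_A_tree_iff)
  qed (auto simp: triple_root_system_A_tree_iff)
  ultimately show ?thesis by (simp only: card_root_walks)
qed

end
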